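(* Let $r,p$ be coprime odd integers with $1\le r<p$ and let $x=r/p$. Let $\sigma_2(x)\in\mathbb{Z}$ denote the signature of the $\mathrm{SU}(2)$-TQFT associated with $x$ for a closed surface of genus $2$. Then $$\sigma_2\left(\frac{x}{2x+1}\right)-\sigma_2(x)=2r^2+2rp+p^2-1 .$$
   Context: For coprime odd integers $1\le r<p$ and $x=r/p$, $\sigma_2(x)\in\mathbb{Z}$ is the signature of the Hermitian form on the vector space attached to a closed surface of genus $2$ by the $\mathrm{SU}(2)$-TQFT determined by $r/p$ (in the sense of Deroin--Marché). Note that $x/(2x+1)=r/(2r+p)$ with $r$ and $2r+p$ again coprime and odd and $1\le r<2r+p$. The only information about $\sigma_2$ used is the following known formula of Marché--Masbaum, which may be taken as the definition of $\sigma_2(x)$: $$\sigma_2(x)=\frac{1}{6p^2}-\frac16+\frac{1}{4p^2}\sum_{\substack{1\le n\le p-2\\ n\text{ odd}}}\frac{T(n;x)}{\sin^3(\pi n/2p)\,\sin^2(\pi n x)},$$ $$T(n;x)=\sum_{\varepsilon\in\{\pm1\}}(p+\varepsilon)\left(\sin\left(\frac{\pi(2r-3\varepsilon)n}{2p}\right)+3\sin\left(\frac{\pi(2r+\varepsilon)n}{2p}\right)\right).$$ *)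

theory Defs
  imports "HOL-Analysis.Analysis"
begin

text \<open>
  Signature of the genus 2 SU(2)-TQFT (in the sense of Deroin and Marche) attached to
  \<open>x = r / p\<close>, taken to be the value of the Marche--Masbaum formula. The formula is only
  meaningful for \<open>r, p\<close> coprime and odd with \<open>1 \<le> r < p\<close>; it then yields an integer, but the
  definition is real-valued because this is not visible from the formula.
\<close>

definition sigma2_T :: "int \<Rightarrow> int \<Rightarrow> int \<Rightarrow> real" where
  "sigma2_T r p n =
     (\<Sum>\<epsilon>\<in>{1, -1::int}. (real_of_int p + real_of_int \<epsilon>) *
        (sin (pi * real_of_int ((2 * r - 3 * \<epsilon>) * n) / (2 * real_of_int p))
         + 3 * sin (pi * real_of_int ((2 * r + \<epsilon>) * n) / (2 * real_of_int p))))"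

text \<open>\<open>quotient_of x\<close> is the unique pair \<open>(r, p)\<close> with \<open>x = r / p\<close> in lowest terms and \<open>p > 0\<close>.\<close>

definition sigma2 :: "rat \<Rightarrow> real" where
  "sigma2 x =
     (let (r, p) = quotient_of x in
        1 / (6 * (real_of_int p)\<^sup>2) - 1 / 6
        + 1 / (4 * (real_of_int p)\<^sup>2) *
          (\<Sum>n | 1 \<le> n \<and> n \<le> p - 2 \<and> odd n.
             sigma2_T r p n /
             ((sin (pi * real_of_int n / (2 * real_of_int p))) ^ 3 *
              (sin (pi * real_of_int n * real_of_rat x))\<^sup>2)))"

end

theory Submission
  imports Defs "HOL-Real_Asymp.Real_Asymp" "HOL-Number_Theory.Cong"
begin

text \<open>
  Write \<open>\<theta>\<close> for the angles \<open>\<pi> n / (2 p)\<close> with \<open>n\<close> odd, \<open>0 < n < 2 p\<close>. Expanding the sines in the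
  numerator of the Marche--Masbaum formula turns each summand into
  \<open>8 (p cot\<^sup>3 \<theta> / sin (2 r \<theta>) + cos (2 r \<theta>) / sin\<^sup>2 (2 r \<theta>))\<close>. Multiplication by \<open>r\<close> permutes the odd
  residues modulo \<open>2 p\<close>, so the second part does not depend on \<open>r\<close>; it can be evaluated, and it cancels
  the constant terms (\<open>sum_cos_csc2\<close>, \<open>sigma2_eq_cot3_csc_sum\<close>). What is left is
  \<open>\<sigma>\<^sub>2 (r / p) = (1 / p) \<Sum> cot\<^sup>3 \<theta> / sin (2 r \<theta>)\<close>, summed over all \<open>\<theta>\<close>.
  
  This is minus the sum of the residues of \<open>f z = cot\<^sup>3 z tan (p z) / sin (2 r z)\<close> at the poles of
  \<open>tan (p z)\<close>. As \<open>f\<close> has period \<open>\<pi>\<close> and decays towards \<open>\<plusminus>i\<infinity>\<close>, the residues in a period add up to 0.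
  At the nonzero multiples of \<open>\<pi> / (2 r)\<close> the residue depends on \<open>p\<close> only modulo \<open>2 r\<close>; at 0 it is
  the polynomial \<open>Q p = (p\<^sup>3 + 2 p r\<^sup>2 - 3 p) / (6 r)\<close>. Since \<open>x / (2 x + 1) = r / (p + 2 r)\<close>, the difference of
  the two signatures is \<open>Q (p + 2 r) - Q p = 2 r\<^sup>2 + 2 r p + p\<^sup>2 - 1\<close>.
  
  The residue theorem is replaced by finite sums. Partial fractions of \<open>1 / sin (2 r z)\<close>
  (\<open>csc_partial_fractions\<close>) turn the sum into a double sum of \<open>cot\<^sup>3 \<theta> cot (\<theta> - \<phi>)\<close> with
  \<open>\<phi> = \<pi> k / (2 r)\<close>, and the addition theorem of the cotangent moves the cube from \<open>\<theta>\<close> to \<open>\<phi>\<close>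
  (\<open>cot3_mult_cot_diff\<close>). Then the sum over \<open>\<theta>\<close> has a closed form, and
  \<open>cot3_csc_sum_reciprocity\<close> results. All closed forms come from the single identity
  \<open>\<Sum>\<^sub>k cot (z + \<pi> k / m) = m cot (m z)\<close> (\<open>sum_cot_shifts\<close>), its derivatives and a limit.
\<close>

section \<open>Cotangent sums over equally spaced points\<close>

lemma cot_eq_cis:
  assumes "sin y \<noteq> 0"
  shows "complex_of_real (cot y) = \<i> * (1 + 2 / (cis (2 * y) - 1))"
proof -
  have cis2: "cis (2 * y) - 1 = 2 * \<i> * of_real (sin y) * cis y"
    by (auto simp: complex_eq_iff cos_double_sin sin_double power2_eq_square)
  have nz: "complex_of_real (sin y) \<noteq> 0" "cis y \<noteq> 0" using assms by auto
  have "(\<i> * of_real (sin y) - of_real (cos y)) * cis y = -1"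
    using sin_cos_squared_add[of y]
    by (simp add: complex_eq_iff power2_eq_square algebra_simps)
  then have "of_real (cos y) * cis y = \<i> * of_real (sin y) * cis y + 1"
    by (simp add: algebra_simps eq_neg_iff_add_eq_0 add_eq_0_iff)
  then show ?thesis
    unfolding cis2 cot_def using nz by (simp add: field_simps)
qed

text \<open>
  Expand each summand as a finite geometric series in \<open>w \<zeta>\<^sup>k\<close>, all of which have the same closing
  power \<open>w ^ m\<close>; summing over the \<open>m\<close>-th roots of unity kills every term but the constant one.
\<close>

lemma sum_inverse_root_of_unity_shift:
  fixes w :: complex
  assumes "m > 0" "w ^ m \<noteq> 1"
  shows "(\<Sum>k<m. 1 / (w * cis (2 * pi * real k / real m) - 1)) = of_nat m / (w ^ m - 1)"
proof -
  define z where "z k = cis (2 * pi * real k / real m)" for k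
  have zm: "z k ^ m = 1" for k
  proof -
    have "z k ^ m = cis (2 * pi * real k)"
      using assms(1) by (simp add: z_def Complex.DeMoivre)
    then show ?thesis by (simp add: cis_multiple_2pi)
  qed
  have *: "(w ^ m - 1) / (w * z k - 1) = (\<Sum>j<m. (w * z k) ^ j)" for k
  proof -
    have "(w * z k) ^ m = w ^ m" by (simp add: power_mult_distrib zm)
    moreover have "w * z k \<noteq> 1" using assms(2) calculation by (metis power_one)
    ultimately show ?thesis using geometric_sum[of "w * z k" m] by simp
  qed
  have zj: "(\<Sum>k<m. z k ^ j) = (if j = 0 then of_nat m else 0)" if "j < m" for j
  proof (cases "j = 0")
    case False
    define q where "q = z j"
    have qk: "z k ^ j = q ^ k" for k
      by (simp add: z_def q_def Complex.DeMoivre mult_ac)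
    have "q \<noteq> 1"
    proof
      assume "q = 1"
      then have "cos (2 * pi * real j / real m) = 1" by (simp add: q_def z_def complex_eq_iff)
      then obtain i :: int where "2 * pi * real j / real m = of_int i * 2 * pi"
        using cos_one_2pi_int by blast
      then have "real_of_int (int j) = real_of_int (i * int m)"
        using assms(1) by (simp add: field_simps)
      then have "int j = i * int m" by linarith
      then have "int m dvd int j" by simp
      then show False using that False by (auto dest: dvd_imp_le)
    qed
    moreover have "q ^ m = 1" by (simp add: q_def zm)
    ultimately show ?thesis using False geometric_sum[of q m] by (simp add: qk)
  qed simp
  have "(w ^ m - 1) * (\<Sum>k<m. 1 / (w * z k - 1)) = (\<Sum>k<m. \<Sum>j<m. (w * z k) ^ j)"
    by (simp add: sum_distrib_left * [symmetric])
  also have "\<dots> = (\<Sum>j<m. w ^ j * (\<Sum>k<m. z k ^ j))"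
    by (subst sum.swap) (simp add: power_mult_distrib sum_distrib_left)
  also have "\<dots> = (\<Sum>j<m. if j = 0 then of_nat m else 0)"
    by (rule sum.cong) (auto simp: zj)
  also have "\<dots> = of_nat m" using assms(1) by simp
  finally show ?thesis using assms(2) by (simp add: z_def field_simps)
qed

lemma sin_multiple_eq_0I:
  fixes y :: real
  assumes "sin y = 0" shows "sin (real m * y) = 0"
proof -
  obtain i :: int where "y = of_int i * pi" using assms by (auto simp: sin_zero_iff_int2)
  then have "real m * y = of_int (int m * i) * pi" by simp
  then show ?thesis using sin_zero_iff_int2 by blast
qed

lemma sin_shifted_nonzero:
  assumes "sin (real m * z) \<noteq> 0"
  shows "sin (z + pi * real k / real m) \<noteq> 0"
proof
  assume "sin (z + pi * real k / real m) = 0"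
  then have "sin (real m * (z + pi * real k / real m)) = 0" by (rule sin_multiple_eq_0I)
  moreover have "m \<noteq> 0" using assms by (cases "m = 0") auto
  then have "real m * (z + pi * real k / real m) = real m * z + real k * pi"
    by (simp add: field_simps)
  ultimately show False using assms by (simp add: sin_add)
qed

text \<open>
  The finite partial fraction expansion of the cotangent, on which all other sums of this file
  rest. Writing \<open>cot\<close> through \<open>1 / (e\<^sup>2\<^sup>i\<^sup>z - 1)\<close> turns it into the preceding identity.
\<close>

lemma sum_cot_shifts:
  assumes "sin (real m * z) \<noteq> 0"
  shows "(\<Sum>k<m. cot (z + pi * real k / real m)) = real m * cot (real m * z)"
proof -
  have m: "m > 0" using assms by (cases "m = 0") auto
  have pw: "cis (2 * z) ^ m = cis (2 * (real m * z))" by (simp add: Complex.DeMoivre mult_ac)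
  have w: "cis (2 * z) ^ m \<noteq> 1"
  proof
    assume "cis (2 * z) ^ m = 1"
    then have "cos (2 * (real m * z)) = 1" by (simp add: pw complex_eq_iff)
    then show False using assms by (simp add: cos_double_sin)
  qed
  have "complex_of_real (\<Sum>k<m. cot (z + pi * real k / real m))
      = (\<Sum>k<m. \<i> * (1 + 2 / (cis (2 * (z + pi * real k / real m)) - 1)))"
    by (simp add: cot_eq_cis sin_shifted_nonzero[OF assms])
  also have "\<dots> = \<i> * of_nat m
       + 2 * \<i> * (\<Sum>k<m. 1 / (cis (2 * z) * cis (2 * pi * real k / real m) - 1))"
    by (simp add: cis_mult sum.distrib sum_distrib_left ring_distribs mult_ac)
  also have "\<dots> = \<i> * of_nat m + 2 * \<i> * (of_nat m / (cis (2 * (real m * z)) - 1))"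
    using sum_inverse_root_of_unity_shift[OF m w] by (simp add: pw)
  also have "\<dots> = complex_of_real (real m * cot (real m * z))"
    unfolding of_real_mult cot_eq_cis[OF assms] by (simp add: ring_distribs)
  finally show ?thesis using of_real_eq_iff by blast
qed

lemma open_sin_multiple_nonzero: "open {z. sin (real m * z) \<noteq> 0}"
  by (intro open_Collect_neq continuous_intros)

text \<open>
  Differentiation of the cotangent identity; the next lemma differentiates twice more, which is
  how the combination \<open>6 csc\<^sup>4 - 4 csc\<^sup>2 = (csc\<^sup>2)''\<close> arises.
\<close>

lemma sum_csc2_shifts:
  assumes "sin (real m * z) \<noteq> 0"
  shows "(\<Sum>k<m. 1 / (sin (z + pi * real k / real m))\<^sup>2) = (real m)\<^sup>2 / (sin (real m * z))\<^sup>2"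
proof -
  have cot': "((\<lambda>x. cot (g x)) has_real_derivative - (g' / (sin (g x))\<^sup>2)) (at x)"
    if "(g has_real_derivative g') (at x)" "sin (g x) \<noteq> 0" for g g' x
    using DERIV_chain2[OF DERIV_cot[OF that(2)] that(1)] by (simp add: field_simps)
  have "((\<lambda>z. \<Sum>k<m. cot (z + pi * real k / real m)) has_real_derivative
         (\<Sum>k<m. - (1 / (sin (z + pi * real k / real m))\<^sup>2))) (at z)"
    by (intro DERIV_sum cot' sin_shifted_nonzero assms) (auto intro!: derivative_eq_intros)
  then have "((\<lambda>z. real m * cot (real m * z)) has_real_derivative
         (\<Sum>k<m. - (1 / (sin (z + pi * real k / real m))\<^sup>2))) (at z)"
    by (rule has_field_derivative_transform_within_open[OF _ open_sin_multiple_nonzero])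
       (use assms sum_cot_shifts in auto)
  moreover have "((\<lambda>z. real m * cot (real m * z)) has_real_derivative
         real m * (- (real m / (sin (real m * z))\<^sup>2))) (at z)"
    by (intro DERIV_cmult cot' assms) (auto intro!: derivative_eq_intros)
  ultimately have "(\<Sum>k<m. - (1 / (sin (z + pi * real k / real m))\<^sup>2))
      = real m * (- (real m / (sin (real m * z))\<^sup>2))"
    by (rule DERIV_unique)
  then show ?thesis by (simp add: sum_negf power2_eq_square)
qed

lemma sum_csc4_shifts:
  assumes "sin (real m * z) \<noteq> 0"
  shows "(\<Sum>k<m. 6 / (sin (z + pi * real k / real m)) ^ 4 - 4 / (sin (z + pi * real k / real m))\<^sup>2)
      = (real m) ^ 4 * (6 / (sin (real m * z)) ^ 4 - 4 / (sin (real m * z))\<^sup>2)"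
proof -
  have d1: "((\<lambda>x. 1 / (sin (c * x + d))\<^sup>2) has_real_derivative
       c * (- 2 * cos (c * x + d) / (sin (c * x + d)) ^ 3)) (at x)"
    if "sin (c * x + d) \<noteq> 0" for c d x :: real
    using that by (auto intro!: derivative_eq_intros simp: field_simps eval_nat_numeral)
  have d2: "((\<lambda>x. - 2 * cos (c * x + d) / (sin (c * x + d)) ^ 3) has_real_derivative
       c * (6 / (sin (c * x + d)) ^ 4 - 4 / (sin (c * x + d))\<^sup>2)) (at x)"
    if nz: "sin (c * x + d) \<noteq> 0" for c d x :: real
  proof -
    have c2: "cos (c * x + d) * cos (c * x + d) = 1 - sin (c * x + d) * sin (c * x + d)"
      using cos_squared_eq[of "c * x + d"] by (simp add: power2_eq_square)
    have alg: "(2 * (s * c) * s ^ 3 + 2 * C * (3 * s ^ 2 * (C * c))) / (s ^ 3 * s ^ 3)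
        = c * (6 / s ^ 4 - 4 / s\<^sup>2)" if "s \<noteq> 0" "C * C = 1 - s * s" for s C :: real
    proof -
      have "(2 * (s * c) * s ^ 3 + 2 * C * (3 * s ^ 2 * (C * c)))
          = c * s ^ 2 * (2 * s ^ 2 + 6 * (C * C))" by (simp add: algebra_simps eval_nat_numeral)
      also have "\<dots> = c * s ^ 2 * (6 - 4 * s ^ 2)" by (simp add: that(2) power2_eq_square algebra_simps)
      finally have N: "2 * (s * c) * s ^ 3 + 2 * C * (3 * s ^ 2 * (C * c)) = c * s ^ 2 * (6 - 4 * s ^ 2)" .
      show ?thesis unfolding N using that(1) by (simp add: field_simps eval_nat_numeral)
    qed
    show ?thesis
      by (rule derivative_eq_intros refl nz | simp add: nz)+
         (use alg[OF nz c2] nz in \<open>simp add: field_simps eval_nat_numeral\<close>)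
  qed
  have eq1: "(\<Sum>k<m. - 2 * cos (z + pi * real k / real m) / (sin (z + pi * real k / real m)) ^ 3)
      = (real m)\<^sup>2 * (real m * (- 2 * cos (real m * z) / (sin (real m * z)) ^ 3))"
    if nz: "sin (real m * z) \<noteq> 0" for z
  proof -
    have "((\<lambda>z. \<Sum>k<m. 1 / (sin (z + pi * real k / real m))\<^sup>2) has_real_derivative
       (\<Sum>k<m. - 2 * cos (z + pi * real k / real m) / (sin (z + pi * real k / real m)) ^ 3)) (at z)"
      by (intro DERIV_sum) (use d1[of 1 z] sin_shifted_nonzero[OF nz] in simp)
    then have "((\<lambda>z. (real m)\<^sup>2 * (1 / (sin (real m * z))\<^sup>2)) has_real_derivative
       (\<Sum>k<m. - 2 * cos (z + pi * real k / real m) / (sin (z + pi * real k / real m)) ^ 3)) (at z)"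
      by (rule has_field_derivative_transform_within_open[OF _ open_sin_multiple_nonzero])
         (use nz sum_csc2_shifts in auto)
    moreover have "((\<lambda>z. (real m)\<^sup>2 * (1 / (sin (real m * z))\<^sup>2)) has_real_derivative
       (real m)\<^sup>2 * (real m * (- 2 * cos (real m * z) / (sin (real m * z)) ^ 3))) (at z)"
      by (intro DERIV_cmult) (use d1[of "real m" z 0] nz in simp)
    ultimately show ?thesis by (rule DERIV_unique)
  qed
  have "((\<lambda>z. \<Sum>k<m. - 2 * cos (z + pi * real k / real m) / (sin (z + pi * real k / real m)) ^ 3)
     has_real_derivative (\<Sum>k<m. 6 / (sin (z + pi * real k / real m)) ^ 4
         - 4 / (sin (z + pi * real k / real m))\<^sup>2)) (at z)"
    by (intro DERIV_sum) (use d2[of 1 z] sin_shifted_nonzero[OF assms] in simp)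
  then have "((\<lambda>z. (real m)\<^sup>2 * (real m * (- 2 * cos (real m * z) / (sin (real m * z)) ^ 3)))
     has_real_derivative (\<Sum>k<m. 6 / (sin (z + pi * real k / real m)) ^ 4
         - 4 / (sin (z + pi * real k / real m))\<^sup>2)) (at z)"
    by (rule has_field_derivative_transform_within_open[OF _ open_sin_multiple_nonzero])
       (use assms eq1 in auto)
  moreover have "((\<lambda>z. (real m)\<^sup>2 * (real m * (- 2 * cos (real m * z) / (sin (real m * z)) ^ 3)))
     has_real_derivative (real m)\<^sup>2 * (real m *
        (real m * (6 / (sin (real m * z)) ^ 4 - 4 / (sin (real m * z))\<^sup>2)))) (at z)"
    by (intro DERIV_cmult) (use d2[of "real m" z 0] assms in simp)
  ultimately have "(\<Sum>k<m. 6 / (sin (z + pi * real k / real m)) ^ 4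
         - 4 / (sin (z + pi * real k / real m))\<^sup>2)
      = (real m)\<^sup>2 * (real m *
        (real m * (6 / (sin (real m * z)) ^ 4 - 4 / (sin (real m * z))\<^sup>2)))" by (rule DERIV_unique)
  then show ?thesis by (simp add: eval_nat_numeral mult_ac)
qed

text \<open>
  The preceding sum without its term \<open>k = 0\<close> is continuous at \<open>z = 0\<close>, so its value there is the
  limit of \<open>m\<^sup>2 csc\<^sup>2 (m z) - csc\<^sup>2 z\<close>.
\<close>

lemma sum_csc2_roots:
  assumes "m > 0"
  shows "(\<Sum>k=1..<m. 1 / (sin (pi * real k / real m))\<^sup>2) = ((real m)\<^sup>2 - 1) / 3"
proof -
  let ?f = "\<lambda>z. \<Sum>k=1..<m. 1 / (sin (z + pi * real k / real m))\<^sup>2"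
  have nz: "sin (0 + pi * real k / real m) \<noteq> 0" if "k \<in> {1..<m}" for k
  proof -
    have "0 < pi * real k / real m" "pi * real k / real m < pi"
      using that by (auto simp: field_simps)
    then show ?thesis using sin_gt_zero by force
  qed
  have "isCont ?f 0" by (intro continuous_intros) (use nz in auto)
  then have lim1: "?f \<midarrow>0\<rightarrow> ?f 0" by (simp add: isCont_def)
  have m0: "real m > 0" using assms by simp
  have lim2: "((\<lambda>z::real. (real m)\<^sup>2 / (sin (real m * z))\<^sup>2 - 1 / (sin z)\<^sup>2)
         \<longlongrightarrow> ((real m)\<^sup>2 - 1) / 3) (at 0)"
    using m0 by real_asymp (auto simp: field_simps power2_eq_square)
  have "eventually (\<lambda>z::real. sin (real m * z) \<noteq> 0) (at 0)"
    unfolding eventually_at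
  proof (intro exI[of _ "pi / real m"] conjI ballI impI)
    fix z :: real assume z: "z \<noteq> 0 \<and> dist z 0 < pi / real m"
    then have "0 < real m * \<bar>z\<bar>" "real m * \<bar>z\<bar> < pi" using m0 by (auto simp: field_simps)
    then have "sin (real m * \<bar>z\<bar>) > 0" by (rule sin_gt_zero)
    then show "sin (real m * z) \<noteq> 0" by (cases "z \<ge> 0") auto
  qed (use m0 in simp)
  then have ev: "eventually (\<lambda>z. (real m)\<^sup>2 / (sin (real m * z))\<^sup>2 - 1 / (sin z)\<^sup>2 = ?f z) (at 0)"
  proof eventually_elim
    case (elim z)
    have "(real m)\<^sup>2 / (sin (real m * z))\<^sup>2 = (\<Sum>k\<in>{0..<m}. 1 / (sin (z + pi * real k / real m))\<^sup>2)"
      using sum_csc2_shifts[OF elim] by (simp add: lessThan_atLeast0)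
    also have "\<dots> = 1 / (sin z)\<^sup>2 + ?f z"
      using assms by (simp add: sum.atLeast_Suc_lessThan)
    finally show ?case by simp
  qed
  have "?f \<midarrow>0\<rightarrow> ((real m)\<^sup>2 - 1) / 3"
    using tendsto_cong[OF ev] lim2 by simp
  then show ?thesis using LIM_unique[OF lim1] by simp
qed

section \<open>Moments of the cotangent at the odd angles\<close>

definition odd_angle :: "nat \<Rightarrow> nat \<Rightarrow> real" where
  "odd_angle p j = pi * real (2 * j + 1) / (2 * real p)"

lemma odd_angle_eq_shift:
  "p > 0 \<Longrightarrow> odd_angle p j = pi / (2 * real p) + pi * real j / real p"
  by (simp add: odd_angle_def field_simps)

lemma sin_odd_angle_pos: "j < p \<Longrightarrow> sin (odd_angle p j) > 0"
proof (rule sin_gt_zero)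
  assume "j < p"
  then have "0 < real (2 * j + 1) / real (2 * p)" "real (2 * j + 1) / real (2 * p) < 1"
    by simp_all
  then show "odd_angle p j > 0" "odd_angle p j < pi"
    using mult_strict_left_mono[of "real (2 * j + 1) / real (2 * p)" 1 pi]
      mult_pos_pos[of pi "real (2 * j + 1) / real (2 * p)"]
    by (simp_all add: odd_angle_def)
qed

text \<open>
  Multiplication by \<open>p\<close> sends every odd angle to an odd multiple of \<open>\<pi> / 2\<close>, where the sine is
  \<open>\<plusminus>1\<close>. Hence the general identities give the moments of \<open>csc\<close>, and so those of \<open>cot\<close>, as
  polynomials in \<open>p\<close>.
\<close>

lemma sum_csc2_odd_angle:
  assumes "p > 0"
  shows "(\<Sum>j<p. 1 / (sin (odd_angle p j))\<^sup>2) = (real p)\<^sup>2"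
  using sum_csc2_shifts[of p "pi / (2 * real p)"] assms
  by (simp add: odd_angle_eq_shift)

lemma sum_csc4_odd_angle:
  assumes "p > 0"
  shows "(\<Sum>j<p. 1 / (sin (odd_angle p j)) ^ 4) = ((real p) ^ 4 + 2 * (real p)\<^sup>2) / 3"
proof -
  have "(\<Sum>j<p. 6 / (sin (odd_angle p j)) ^ 4 - 4 / (sin (odd_angle p j))\<^sup>2) = 2 * (real p) ^ 4"
    using sum_csc4_shifts[of p "pi / (2 * real p)"] assms
    by (simp add: odd_angle_eq_shift)
  moreover have "(\<Sum>j<p. 6 / (sin (odd_angle p j)) ^ 4 - 4 / (sin (odd_angle p j))\<^sup>2)
      = 6 * (\<Sum>j<p. 1 / (sin (odd_angle p j)) ^ 4) - 4 * (\<Sum>j<p. 1 / (sin (odd_angle p j))\<^sup>2)"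
    by (simp add: sum_subtractf sum_distrib_left)
  ultimately show ?thesis using sum_csc2_odd_angle[OF assms] by simp
qed

lemma cot_squared: "sin y \<noteq> 0 \<Longrightarrow> (cot y)\<^sup>2 = 1 / (sin y)\<^sup>2 - 1" for y :: real
  by (simp add: cot_def power_divide cos_squared_eq diff_divide_distrib)

lemma sum_cot2_odd_angle:
  assumes "p > 0"
  shows "(\<Sum>j<p. (cot (odd_angle p j))\<^sup>2) = (real p)\<^sup>2 - real p"
proof -
  have "(\<Sum>j<p. (cot (odd_angle p j))\<^sup>2) = (\<Sum>j<p. 1 / (sin (odd_angle p j))\<^sup>2 - 1)"
    by (rule sum.cong) (use sin_odd_angle_pos in \<open>force simp: cot_squared\<close>)+
  then show ?thesis by (simp add: sum_subtractf sum_csc2_odd_angle[OF assms])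
qed

lemma sum_cot4_odd_angle:
  assumes "p > 0"
  shows "(\<Sum>j<p. (cot (odd_angle p j)) ^ 4) = ((real p) ^ 4 - 4 * (real p)\<^sup>2) / 3 + real p"
proof -
  have "(cot (odd_angle p j)) ^ 4 = 1 / (sin (odd_angle p j)) ^ 4 - 2 * (1 / (sin (odd_angle p j))\<^sup>2) + 1"
    if "j < p" for j
  proof -
    have "(cot (odd_angle p j)) ^ 4 = ((cot (odd_angle p j))\<^sup>2)\<^sup>2" by simp
    also have "\<dots> = (1 / (sin (odd_angle p j))\<^sup>2 - 1)\<^sup>2"
      using sin_odd_angle_pos[OF that] by (simp add: cot_squared)
    finally show ?thesis by (simp add: power2_diff power_divide)
  qed
  then have "(\<Sum>j<p. (cot (odd_angle p j)) ^ 4)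
     = (\<Sum>j<p. 1 / (sin (odd_angle p j)) ^ 4 - 2 * (1 / (sin (odd_angle p j))\<^sup>2) + 1)"
    by simp
  also have "\<dots> = (\<Sum>j<p. 1 / (sin (odd_angle p j)) ^ 4) - 2 * (\<Sum>j<p. 1 / (sin (odd_angle p j))\<^sup>2) + real p"
    by (simp add: sum.distrib sum_subtractf sum_distrib_left)
  finally show ?thesis
    by (simp add: sum_csc2_odd_angle[OF assms] sum_csc4_odd_angle[OF assms] field_simps)
qed

lemma odd_angle_reflect: "j < p \<Longrightarrow> odd_angle p (p - Suc j) = pi - odd_angle p j"
  by (simp add: odd_angle_def field_simps of_nat_diff)

lemma cot_pi_minus: "cot (pi - y) = - cot y" for y :: real
  by (simp add: cot_def)

lemma sum_cot_odd_power_odd_angle: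
  assumes "odd i"
  shows "(\<Sum>j<p. (cot (odd_angle p j)) ^ i) = 0"
proof -
  have "(\<Sum>j<p. (cot (odd_angle p j)) ^ i) = (\<Sum>j<p. (cot (odd_angle p (p - Suc j))) ^ i)"
    by (rule sum.nat_diff_reindex [symmetric])
  also have "\<dots> = (\<Sum>j<p. - (cot (odd_angle p j) ^ i))"
    by (rule sum.cong) (use assms in \<open>auto simp: odd_angle_reflect cot_pi_minus power_minus_odd\<close>)
  finally show ?thesis by (simp add: sum_negf)
qed

lemma sum_cot_odd_angle_diff:
  assumes "p > 0" "cos (real p * y) \<noteq> 0"
  shows "(\<Sum>j<p. cot (odd_angle p j - y)) = real p * tan (real p * y)"
    and "\<And>j. sin (odd_angle p j - y) \<noteq> 0"
proof -
  have e: "real p * (pi / (2 * real p) - y) = pi / 2 - real p * y"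
    using assms(1) by (simp add: field_simps)
  have nz: "sin (real p * (pi / (2 * real p) - y)) \<noteq> 0"
    unfolding e using assms(2) by (simp add: sin_diff)
  have sh: "odd_angle p j - y = pi / (2 * real p) - y + pi * real j / real p" for j
    using assms(1) by (simp add: odd_angle_eq_shift)
  show "\<And>j. sin (odd_angle p j - y) \<noteq> 0"
    unfolding sh by (rule sin_shifted_nonzero[OF nz])
  show "(\<Sum>j<p. cot (odd_angle p j - y)) = real p * tan (real p * y)"
    unfolding sh sum_cot_shifts[OF nz] e by (simp add: cot_def tan_def sin_diff cos_diff)
qed

section \<open>Sums of products of cotangents\<close>

text \<open>
  With \<open>a = cot x\<close> and \<open>b = cot y\<close> the addition theorem reads \<open>cot (x - y) (b - a) = 1 + a b\<close>, so
  \<open>(a\<^sup>3 - b\<^sup>3) cot (x - y)\<close> is a polynomial in \<open>a\<close> and \<open>b\<close>. This trades \<open>a\<^sup>3\<close> for \<open>b\<^sup>3\<close>, which is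
  independent of the summation variable when \<open>x\<close> runs through the odd angles.
\<close>

lemma cot3_mult_cot_diff:
  fixes x y :: real
  assumes "sin x \<noteq> 0" "sin y \<noteq> 0" "sin (x - y) \<noteq> 0"
  defines "a \<equiv> cot x" and "b \<equiv> cot y"
  shows "a ^ 3 * cot (x - y) = b ^ 3 * cot (x - y) - (a\<^sup>2 + a * b + b\<^sup>2) * (1 + a * b)"
proof -
  have "cot (x - y) * (b - a) = 1 + a * b"
  proof -
    have "b - a = sin (x - y) / (sin x * sin y)" "1 + a * b = cos (x - y) / (sin x * sin y)"
      using assms by (simp_all add: cot_def sin_diff cos_diff field_simps)
    then show ?thesis using assms(3) by (simp add: cot_def)
  qed
  then have "(a\<^sup>2 + a * b + b\<^sup>2) * (1 + a * b) = (a\<^sup>2 + a * b + b\<^sup>2) * (cot (x - y) * (b - a))"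
    by simp
  then show ?thesis by (simp add: algebra_simps eval_nat_numeral)
qed

text \<open>
  If \<open>cos y = 0\<close>, the angle \<open>y\<close> may coincide with an odd angle, and \<open>cot\<close> and \<open>tan\<close> then take the
  value 0 of a division by zero. The formula survives because \<open>cot y = 0\<close> multiplies the affected
  terms on both sides.
\<close>

lemma sum_cot3_mult_cot_diff:
  assumes "p > 0" "sin y \<noteq> 0" "cos (real p * y) \<noteq> 0 \<or> cos y = 0"
  shows "(\<Sum>j<p. cot (odd_angle p j) ^ 3 * cot (odd_angle p j - y))
      = real p * (cot y ^ 3 * tan (real p * y)) - (real p)\<^sup>2 * (cot y)\<^sup>2 - ((real p)\<^sup>2 - real p)"
proof (cases "cos y = 0")
  case True
  have "cot (odd_angle p j) ^ 3 * cot (odd_angle p j - y) = - (cot (odd_angle p j))\<^sup>2"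
    if "j < p" for j
    using sin_odd_angle_pos[OF that] True assms(2)
    by (simp add: cot_def sin_diff cos_diff field_simps eval_nat_numeral)
  then have "(\<Sum>j<p. cot (odd_angle p j) ^ 3 * cot (odd_angle p j - y))
      = - (\<Sum>j<p. (cot (odd_angle p j))\<^sup>2)"
    by (simp add: sum_negf)
  moreover have "cot y = 0" using True by (simp add: cot_def)
  ultimately show ?thesis by (simp add: sum_cot2_odd_angle[OF assms(1)])
next
  case False
  then have c: "cos (real p * y) \<noteq> 0" using assms(3) by simp
  define a where "a j = cot (odd_angle p j)" for j
  define b where "b = cot y"
  have "(\<Sum>j<p. a j ^ 3 * cot (odd_angle p j - y))
     = (\<Sum>j<p. b ^ 3 * cot (odd_angle p j - y) - (a j)\<^sup>2 - b * a j ^ 1 - b\<^sup>2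
          - b * a j ^ 3 - b\<^sup>2 * (a j)\<^sup>2 - b ^ 3 * a j ^ 1)"
  proof (rule sum.cong)
    fix j assume "j \<in> {..<p}"
    then have "sin (odd_angle p j) \<noteq> 0" using sin_odd_angle_pos[of j p] by simp
    from cot3_mult_cot_diff[OF this assms(2) sum_cot_odd_angle_diff(2)[OF assms(1) c]]
    show "a j ^ 3 * cot (odd_angle p j - y) = b ^ 3 * cot (odd_angle p j - y) - (a j)\<^sup>2 - b * a j ^ 1 - b\<^sup>2
          - b * a j ^ 3 - b\<^sup>2 * (a j)\<^sup>2 - b ^ 3 * a j ^ 1"
      unfolding a_def b_def by (simp add: algebra_simps eval_nat_numeral)
  qed simp
  also have "\<dots> = b ^ 3 * (\<Sum>j<p. cot (odd_angle p j - y)) - (\<Sum>j<p. (a j)\<^sup>2) - b * (\<Sum>j<p. a j ^ 1)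
      - real p * b\<^sup>2 - b * (\<Sum>j<p. a j ^ 3) - b\<^sup>2 * (\<Sum>j<p. (a j)\<^sup>2) - b ^ 3 * (\<Sum>j<p. a j ^ 1)"
    by (simp only: sum_subtractf sum_distrib_left sum_constant card_lessThan)
  also have "\<dots> = b ^ 3 * (real p * tan (real p * y)) - ((real p)\<^sup>2 - real p)
      - real p * b\<^sup>2 - b\<^sup>2 * ((real p)\<^sup>2 - real p)"
    unfolding a_def sum_cot_odd_angle_diff(1)[OF assms(1) c] sum_cot2_odd_angle[OF assms(1)]
    using sum_cot_odd_power_odd_angle[of 1 p] sum_cot_odd_power_odd_angle[of 3 p] by simp
  finally show ?thesis unfolding a_def b_def by (simp add: algebra_simps)
qed

lemma sum_alternating_split:
  fixes h :: "nat \<Rightarrow> real"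
  shows "(\<Sum>k<2 * r. (-1) ^ k * h k) = (\<Sum>i<r. h (2 * i)) - (\<Sum>i<r. h (2 * i + 1))"
  by (induction r) simp_all

text \<open>
  The even and the odd \<open>k\<close> contribute \<open>r cot (r z)\<close> and \<open>r tan (r z)\<close>, and
  \<open>cot u + tan u = 2 / sin (2 u)\<close>.
\<close>

lemma csc_partial_fractions:
  assumes "sin (2 * real r * z) \<noteq> 0"
  shows "2 * real r / sin (2 * real r * z)
      = (\<Sum>k<2 * r. (-1) ^ k * cot (z - pi * real k / (2 * real r)))"
proof -
  have r: "real r > 0" using assms by (cases "r = 0") auto
  have d: "sin (2 * real r * z) = 2 * sin (real r * z) * cos (real r * z)"
    using sin_double[of "real r * z"] by (simp add: mult.assoc)
  have nz: "sin (real r * z) \<noteq> 0" "cos (real r * z) \<noteq> 0" using assms by (auto simp: d)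
  have cm: "cot (- y) = - cot y" for y :: real by (simp add: cot_def)
  have even: "(\<Sum>i<r. cot (z - pi * real (2 * i) / (2 * real r))) = real r * cot (real r * z)"
  proof -
    have "(\<Sum>i<r. cot (z - pi * real (2 * i) / (2 * real r)))
        = (\<Sum>i<r. - cot (- z + pi * real i / real r))"
      by (subst cm [symmetric]) simp
    also have "\<dots> = real r * cot (real r * z)"
      using sum_cot_shifts[of r "- z"] nz by (simp add: sum_negf cm)
    finally show ?thesis .
  qed
  have odd: "(\<Sum>i<r. cot (z - pi * real (2 * i + 1) / (2 * real r))) = - real r * tan (real r * z)"
  proof -
    have "(\<Sum>i<r. cot (z - pi * real (2 * i + 1) / (2 * real r)))
        = (\<Sum>i<r. - cot (odd_angle r i - z))"
      by (subst cm [symmetric]) (simp add: odd_angle_def)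
    then show ?thesis using sum_cot_odd_angle_diff(1)[of r z] nz r by (simp add: sum_negf)
  qed
  have "real r * cot (real r * z) + real r * tan (real r * z) = 2 * real r / sin (2 * real r * z)"
  proof -
    have "cot (real r * z) + tan (real r * z)
        = ((sin (real r * z))\<^sup>2 + (cos (real r * z))\<^sup>2) / (sin (real r * z) * cos (real r * z))"
      using nz by (simp add: cot_def tan_def power2_eq_square add_divide_distrib)
    then show ?thesis by (simp add: d flip: distrib_left)
  qed
  then show ?thesis
    unfolding sum_alternating_split even odd by simp
qed

text \<open>
  The terms \<open>k = 0\<close> and \<open>k = r\<close> both vanish: the first because \<open>cot 0 = 0\<close> as a division by zero,
  the second because \<open>cot (\<pi> / 2) = 0\<close>.
\<close>

lemma sum_alternating_cot2:
  assumes "r > 0"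
  shows "(\<Sum>k<2 * r. (-1) ^ k * (cot (pi * real k / (2 * real r)))\<^sup>2) = - 2 * ((real r)\<^sup>2 - 1) / 3"
proof -
  have "(\<Sum>i<r. (cot (pi * real (2 * i) / (2 * real r)))\<^sup>2)
      = (\<Sum>i\<in>{0..<r}. (cot (pi * real i / real r))\<^sup>2)"
    by (simp add: lessThan_atLeast0)
  also have "\<dots> = (\<Sum>i=1..<r. (cot (pi * real i / real r))\<^sup>2)"
    using assms by (simp add: sum.atLeast_Suc_lessThan)
  also have "\<dots> = (\<Sum>i=1..<r. 1 / (sin (pi * real i / real r))\<^sup>2 - 1)"
  proof (rule sum.cong)
    fix i assume "i \<in> {1..<r}"
    then have "0 < pi * real i / real r" "pi * real i / real r < pi"
      by (auto simp: field_simps)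
    then have "sin (pi * real i / real r) > 0" by (rule sin_gt_zero)
    then show "(cot (pi * real i / real r))\<^sup>2 = 1 / (sin (pi * real i / real r))\<^sup>2 - 1"
      by (simp add: cot_squared)
  qed simp
  also have "\<dots> = ((real r)\<^sup>2 - 1) / 3 - (real r - 1)"
    using assms sum_csc2_roots[OF assms] by (simp add: sum_subtractf of_nat_diff)
  finally have even: "(\<Sum>i<r. (cot (pi * real (2 * i) / (2 * real r)))\<^sup>2)
      = ((real r)\<^sup>2 - 1) / 3 - (real r - 1)" .
  have odd: "(\<Sum>i<r. (cot (pi * real (2 * i + 1) / (2 * real r)))\<^sup>2) = (real r)\<^sup>2 - real r"
    using sum_cot2_odd_angle[OF assms] by (simp only: odd_angle_def)
  show ?thesis unfolding sum_alternating_split even odd by (simp add: field_simps)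
qed

section \<open>Reciprocity\<close>

text \<open>
  The middle odd angle \<open>\<pi> / 2\<close>, which occurs for odd \<open>p\<close>, contributes 0.
\<close>

definition cot3_csc_sum :: "nat \<Rightarrow> nat \<Rightarrow> real" where
  "cot3_csc_sum r p = (\<Sum>j<p. cot (odd_angle p j) ^ 3 / sin (2 * real r * odd_angle p j))"

text \<open>
  Up to the factor \<open>1 / (2 r)\<close>, this collects the residues of
  \<open>cot\<^sup>3 z tan (p z) / sin (2 r z)\<close> at the poles \<open>z = \<pi> k / (2 r)\<close> other than 0.
\<close>

definition cot3_tan_sum :: "nat \<Rightarrow> nat \<Rightarrow> real" where
  "cot3_tan_sum r p = (\<Sum>k<2 * r. (-1) ^ k *
     (cot (pi * real k / (2 * real r)) ^ 3 * tan (real p * (pi * real k / (2 * real r)))))"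

lemma cos_odd_angle_zero: "p > 0 \<Longrightarrow> 2 * j + 1 = p \<Longrightarrow> cos (odd_angle p j) = 0"
  by (auto simp: odd_angle_def)

text \<open>
  A zero would force \<open>p k\<close> to be an odd multiple of \<open>r\<close>, so \<open>r\<close> would divide \<open>k\<close>.
\<close>

lemma cos_multiple_nonzero:
  assumes "coprime r p" "0 < k" "k < 2 * r" "k \<noteq> r"
  shows "cos (real p * (pi * real k / (2 * real r))) \<noteq> 0"
proof
  assume "cos (real p * (pi * real k / (2 * real r))) = 0"
  then obtain i :: int where i: "odd i" "real p * (pi * real k / (2 * real r)) = of_int i * (pi / 2)"
    by (auto simp: cos_zero_iff_int)
  then have "real_of_int (int p * int k) = real_of_int (i * int r)"
    using assms by (simp add: field_simps)
  then have "int p * int k = i * int r" by linarith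
  then have "int r dvd int p * int k" by simp
  then have "r dvd p * k" by (metis of_nat_dvd_iff of_nat_mult)
  then have "r dvd k" using assms(1) by (simp add: coprime_dvd_mult_right_iff)
  then obtain c where "k = r * c" ..
  with assms(2-4) show False by (cases c rule: nat.exhaust; cases "c \<ge> 2") auto
qed

lemma sin_multiple_nonzero:
  assumes "coprime r p" "j < p" "2 * j + 1 \<noteq> p"
  shows "sin (2 * real r * odd_angle p j) \<noteq> 0"
proof
  assume "sin (2 * real r * odd_angle p j) = 0"
  then obtain i :: int where *: "2 * real r * odd_angle p j = of_int i * pi"
    by (auto simp: sin_zero_iff_int2)
  then have "real_of_int (int r * int (2 * j + 1)) = real_of_int (i * int p)"
  proof -
    have "pi * (real r * real (2 * j + 1)) = pi * (of_int i * real p)"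
      using * assms(2) by (simp add: odd_angle_def field_simps)
    then show ?thesis by simp
  qed
  then have "int r * int (2 * j + 1) = i * int p" by linarith
  then have "int p dvd int r * int (2 * j + 1)" by simp
  then have "p dvd r * (2 * j + 1)" by (metis of_nat_dvd_iff of_nat_mult)
  then have "p dvd 2 * j + 1" using assms(1)
    by (simp add: coprime_dvd_mult_right_iff coprime_commute del: add_Suc_right)
  then obtain c where c: "2 * j + 1 = p * c" ..
  with assms(2,3) have "c \<noteq> 0" "c \<noteq> 1" by (auto intro: Nat.gr0I)
  moreover have "c < 2"
  proof (rule ccontr)
    assume "\<not> c < 2"
    then have "p * 2 \<le> p * c" by simp
    then show False using c assms(2) by linarith
  qed
  ultimately show False by simp
qed

text \<open>
  Expand \<open>1 / sin (2 r z)\<close> at the odd angles into partial fractions and interchange the sums: the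
  inner sum over the odd angles is the one of \<open>sum_cot3_mult_cot_diff\<close>. Only \<open>k = 0\<close> is exceptional;
  there the inner sum is the fourth moment of the cotangent, and it supplies the power \<open>p\<^sup>4\<close>.
\<close>

lemma cot3_csc_sum_reciprocity:
  assumes p: "p > 0" and r: "r > 0" and "coprime r p"
  shows "2 * real r * cot3_csc_sum r p
    = real p * cot3_tan_sum r p + 2 * (real p)\<^sup>2 * ((real r)\<^sup>2 - 1) / 3 + ((real p) ^ 4 - (real p)\<^sup>2) / 3"
proof -
  define a where "a j = odd_angle p j" for j
  define \<phi> where "\<phi> k = pi * real k / (2 * real r)" for k
  define H where "H k = real p * (cot (\<phi> k) ^ 3 * tan (real p * \<phi> k)) - (real p)\<^sup>2 * (cot (\<phi> k))\<^sup>2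
       - ((real p)\<^sup>2 - real p)" for k
  \<comment> \<open>\<open>H k\<close> is the general value of the inner sum and \<open>A\<close> corrects it at \<open>k = 0\<close>, where
    \<open>H 0 = - (p\<^sup>2 - p)\<close> because \<open>cot 0 = 0\<close> as a division by zero.\<close>
  define A where "A = (\<Sum>j<p. cot (a j) ^ 4) + ((real p)\<^sup>2 - real p)"
  have expand: "cot (a j) ^ 3 * (2 * real r / sin (2 * real r * a j))
      = (\<Sum>k<2 * r. (-1) ^ k * (cot (a j) ^ 3 * cot (a j - \<phi> k)))" if "j < p" for j
  proof (cases "2 * j + 1 = p")
    case True
    then have "cot (a j) = 0" using p cos_odd_angle_zero by (simp add: cot_def a_def)
    then show ?thesis by simp
  next
    case False
    show ?thesis
      unfolding a_def \<phi>_def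
        csc_partial_fractions[OF sin_multiple_nonzero[OF assms(3) that False]] sum_distrib_left
      by (simp only: mult_ac)
  qed
  have inner: "(\<Sum>j<p. cot (a j) ^ 3 * cot (a j - \<phi> k)) = H k + (if k = 0 then A else 0)"
    if k: "k < 2 * r" for k
  proof (cases "k = 0")
    case True
    then show ?thesis
      by (simp add: H_def \<phi>_def A_def eval_nat_numeral mult_ac cot_def)
  next
    case False
    have "0 < \<phi> k" "\<phi> k < pi" using False k r by (auto simp: \<phi>_def field_simps)
    then have s: "sin (\<phi> k) \<noteq> 0" using sin_gt_zero by force
    have "cos (real p * \<phi> k) \<noteq> 0 \<or> cos (\<phi> k) = 0"
    proof (cases "k = r")
      case True
      then show ?thesis using r by (simp add: \<phi>_def)
    next
      case False
      then show ?thesis using cos_multiple_nonzero[OF assms(3), of k] \<open>k \<noteq> 0\<close> k by (simp add: \<phi>_def)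
    qed
    then show ?thesis
      using sum_cot3_mult_cot_diff[OF p s] False by (simp add: a_def H_def)
  qed
  have "2 * real r * cot3_csc_sum r p = (\<Sum>j<p. cot (a j) ^ 3 * (2 * real r / sin (2 * real r * a j)))"
    by (simp add: cot3_csc_sum_def a_def sum_distrib_left mult_ac)
  also have "\<dots> = (\<Sum>j<p. \<Sum>k<2 * r. (-1) ^ k * (cot (a j) ^ 3 * cot (a j - \<phi> k)))"
    by (rule sum.cong) (auto simp only: expand lessThan_iff)
  also have "\<dots> = (\<Sum>k<2 * r. (-1) ^ k * (\<Sum>j<p. cot (a j) ^ 3 * cot (a j - \<phi> k)))"
    by (subst sum.swap) (simp add: sum_distrib_left)
  also have "\<dots> = (\<Sum>k<2 * r. (-1) ^ k * H k + (if k = 0 then A else 0))"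
    by (rule sum.cong) (auto simp: inner)
  also have "\<dots> = (\<Sum>k<2 * r. (-1) ^ k * H k) + A"
    using r by (simp add: sum.distrib)
  also have "(\<Sum>k<2 * r. (-1) ^ k * H k) = real p * cot3_tan_sum r p
      - (real p)\<^sup>2 * (\<Sum>k<2 * r. (-1) ^ k * (cot (\<phi> k))\<^sup>2) - ((real p)\<^sup>2 - real p) * (\<Sum>k<2 * r. (-1) ^ k * 1)"
    unfolding H_def cot3_tan_sum_def \<phi>_def
    by (simp only: right_diff_distrib sum_subtractf sum_distrib_left mult_ac mult_1)
  also have "(\<Sum>k<2 * r. (-1) ^ k * (1::real)) = 0"
    by (subst sum_alternating_split) simp
  also have "(\<Sum>k<2 * r. (-1) ^ k * (cot (\<phi> k))\<^sup>2) = - 2 * ((real r)\<^sup>2 - 1) / 3"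
    unfolding \<phi>_def by (rule sum_alternating_cot2[OF r])
  finally show ?thesis
    unfolding A_def a_def sum_cot4_odd_angle[OF p] by (simp add: field_simps)
qed

lemma cot3_tan_sum_periodic: "cot3_tan_sum r (p + 2 * r) = cot3_tan_sum r p"
proof (cases "r = 0")
  case False
  have "real (p + 2 * r) * (pi * real k / (2 * real r))
      = real p * (pi * real k / (2 * real r)) + real k * pi" for k
    using False by (simp add: field_simps)
  moreover have "tan (y + real k * pi) = tan y" for y k
    using tan_periodic_nat[of y k] by simp
  ultimately show ?thesis unfolding cot3_tan_sum_def by (simp only:)
qed (simp add: cot3_tan_sum_def)

text \<open>
  After division by \<open>p\<close> in the reciprocity law, the transcendental part depends on \<open>p\<close> only modulo
  \<open>2 r\<close>. It cancels in the difference, and a cubic polynomial in \<open>p\<close> remains.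
\<close>

lemma cot3_csc_sum_shift:
  assumes "p > 0" "r > 0" "coprime r p"
  shows "cot3_csc_sum r (p + 2 * r) / real (p + 2 * r) - cot3_csc_sum r p / real p
     = 2 * (real r)\<^sup>2 + 2 * real r * real p + (real p)\<^sup>2 - 1"
proof -
  have r: "real r > 0" using assms by simp
  have *: "2 * real r * (cot3_csc_sum r q / real q)
      = cot3_tan_sum r q + 2 * real q * ((real r)\<^sup>2 - 1) / 3 + ((real q) ^ 3 - real q) / 3"
    if "q > 0" "coprime r q" for q
  proof -
    have q: "real q > 0" using that by simp
    have "2 * real r * cot3_csc_sum r q
       = real q * (cot3_tan_sum r q + 2 * real q * ((real r)\<^sup>2 - 1) / 3 + ((real q) ^ 3 - real q) / 3)"
      unfolding cot3_csc_sum_reciprocity[OF that(1) assms(2) that(2)]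
      by (simp add: algebra_simps eval_nat_numeral add_divide_distrib diff_divide_distrib)
    then show ?thesis using q by (simp add: field_simps)
  qed
  have c: "coprime r (p + 2 * r)" using assms(3)
    using gcd_add_mult[of r 2 p] by (simp add: coprime_iff_gcd_eq_1 add.commute)
  have alg: "(D + 2 * (P + 2 * R) * (R\<^sup>2 - 1) / 3 + ((P + 2 * R) ^ 3 - (P + 2 * R)) / 3)
      - (D + 2 * P * (R\<^sup>2 - 1) / 3 + (P ^ 3 - P) / 3)
      = 2 * R * (2 * R\<^sup>2 + 2 * R * P + P\<^sup>2 - 1)" for D P R :: real
    by (simp add: power2_eq_square power3_eq_cube algebra_simps add_divide_distrib diff_divide_distrib)
  have pos: "p + 2 * r > 0" using assms(1) by simp
  have n: "real (p + 2 * r) = real p + 2 * real r" by simp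
  have "2 * real r * (cot3_csc_sum r (p + 2 * r) / real (p + 2 * r) - cot3_csc_sum r p / real p)
      = 2 * real r * (2 * (real r)\<^sup>2 + 2 * real r * real p + (real p)\<^sup>2 - 1)"
    using alg[of "cot3_tan_sum r p" "real p" "real r"] *[OF pos c] *[OF assms(1,3)]
    by (simp only: n cot3_tan_sum_periodic right_diff_distrib[of "2 * real r" "_ / _"])
  then show ?thesis using r by simp
qed

section \<open>The part of the formula that does not depend on r\<close>

lemma sum_lessThan_add: "(\<Sum>j<a + b. f j) = (\<Sum>j<a. f j) + (\<Sum>j<b. f (a + j))"
  for f :: "nat \<Rightarrow> real"
  by (induction b) (simp_all add: add.assoc)

text \<open>
  Multiplication by \<open>r\<close> permutes the odd residues modulo \<open>2 p\<close>.
\<close>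

lemma sum_odd_angle_multiple:
  fixes f :: "real \<Rightarrow> real"
  assumes "odd p" "odd r" "coprime r p" and period: "\<And>y (k::nat). f (y + real k * pi) = f y"
  shows "(\<Sum>j<p. f (real r * odd_angle p j)) = (\<Sum>j<p. f (odd_angle p j))"
proof -
  have p: "p > 0" using assms by (auto intro: Nat.gr0I)
  \<comment> \<open>The residue of \<open>r (2 j + 1)\<close> modulo \<open>2 p\<close> is \<open>2 (\<sigma> j) + 1\<close>.\<close>
  define \<sigma> where "\<sigma> j = (r * (2 * j + 1)) mod (2 * p) div 2" for j
  have \<sigma>: "2 * \<sigma> j + 1 = (r * (2 * j + 1)) mod (2 * p)" for j
  proof -
    have "odd ((r * (2 * j + 1)) mod (2 * p))"
      using assms(2) by (simp add: dvd_mod_iff)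
    then show ?thesis by (simp add: \<sigma>_def)
  qed
  have \<sigma>_less: "\<sigma> j < p" for j
  proof -
    have "2 * \<sigma> j + 1 < 2 * p" unfolding \<sigma> using p by simp
    then show ?thesis by simp
  qed
  have inj: "inj_on \<sigma> {..<p}"
  proof (rule inj_onI)
    fix i j assume ij: "i \<in> {..<p}" "j \<in> {..<p}" "\<sigma> i = \<sigma> j"
    then have "(r * (2 * i + 1)) mod (2 * p) = (r * (2 * j + 1)) mod (2 * p)"
      by (metis \<sigma>)
    then have "[r * (2 * i + 1) = r * (2 * j + 1)] (mod (2 * p))" by (simp only: cong_def)
    moreover have "coprime r (2 * p)" using assms by simp
    ultimately have "[2 * i + 1 = 2 * j + 1] (mod (2 * p))"
      using cong_mult_lcancel_nat by blast
    then show "i = j" using ij(1,2) by (simp add: cong_def)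
  qed
  have img: "\<sigma> ` {..<p} = {..<p}"
    using inj \<sigma>_less by (intro endo_inj_surj) auto
  have "f (real r * odd_angle p j) = f (odd_angle p (\<sigma> j))" for j
  proof -
    define q where "q = (r * (2 * j + 1)) div (2 * p)"
    have "r * (2 * j + 1) = q * (2 * p) + (2 * \<sigma> j + 1)"
      unfolding \<sigma> q_def by (rule div_mult_mod_eq [symmetric])
    from arg_cong[OF this, of real]
    have q: "real r * real (2 * j + 1) = real q * (2 * real p) + real (2 * \<sigma> j + 1)"
      by (simp only: of_nat_add of_nat_mult of_nat_numeral)
    have "real r * odd_angle p j = pi * (real r * real (2 * j + 1)) / (2 * real p)"
      by (simp add: odd_angle_def)
    also have "\<dots> = pi * real q + pi * real (2 * \<sigma> j + 1) / (2 * real p)"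
      unfolding q distrib_left add_divide_distrib using p by simp
    finally have "real r * odd_angle p j = odd_angle p (\<sigma> j) + real q * pi"
      by (simp only: odd_angle_def add.commute mult.commute)
    then show ?thesis by (simp add: period)
  qed
  then have "(\<Sum>j<p. f (real r * odd_angle p j)) = (\<Sum>j<p. f (odd_angle p (\<sigma> j)))" by simp
  also have "\<dots> = (\<Sum>j<p. f (odd_angle p j))"
    using sum.reindex[OF inj, of "\<lambda>j. f (odd_angle p j)"] by (simp add: img)
  finally show ?thesis .
qed

text \<open>
  Adding \<open>\<pi> / 2\<close> moves the odd angles to the multiples of \<open>\<pi> / p\<close>. The middle angle goes to a
  multiple of \<open>\<pi>\<close> and contributes 0, being a division by zero on either side.
\<close>

lemma sum_sec2_odd_angle:
  assumes "p = 2 * h + 1"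
  shows "(\<Sum>j<p. 1 / (cos (odd_angle p j))\<^sup>2) = ((real p)\<^sup>2 - 1) / 3"
proof -
  have p: "p > 0" using assms by simp
  define F where "F k = 1 / (sin (pi * real k / real p))\<^sup>2" for k
  have per: "F (p + k) = F k" for k
  proof -
    have "pi * real (p + k) / real p = pi * real k / real p + pi" using p by (simp add: field_simps)
    then show ?thesis by (simp add: F_def)
  qed
  have cosF: "1 / (cos (odd_angle p j))\<^sup>2 = F (h + 1 + j)" for j
  proof -
    have "pi * real (h + 1 + j) / real p = odd_angle p j + pi / 2"
      using p by (simp add: odd_angle_def assms field_simps)
    then show ?thesis by (simp add: F_def sin_add)
  qed
  have "(\<Sum>j<p. 1 / (cos (odd_angle p j))\<^sup>2) = (\<Sum>j<h + (h + 1). F (h + 1 + j))"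
    by (simp only: cosF) (simp add: assms mult_2)
  also have "\<dots> = (\<Sum>j<h. F (h + 1 + j)) + (\<Sum>j<h + 1. F (p + j))"
    unfolding sum_lessThan_add by (simp add: assms mult_2 add_ac)
  also have "\<dots> = (\<Sum>j<(h + 1) + h. F j)"
    unfolding sum_lessThan_add by (simp add: per)
  also have "\<dots> = (\<Sum>j\<in>{0..<p}. F j)"
    by (simp add: assms mult_2 lessThan_atLeast0)
  also have "\<dots> = (\<Sum>j=1..<p. F j)"
    using p by (simp add: sum.atLeast_Suc_lessThan F_def)
  finally show ?thesis using sum_csc2_roots[OF p] by (simp add: F_def)
qed

lemma cos_odd_angle_eq_0_iff:
  assumes "p = 2 * h + 1" "j < p"
  shows "cos (odd_angle p j) = 0 \<longleftrightarrow> j = h"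
proof
  assume "j = h" then show "cos (odd_angle p j) = 0"
    using cos_odd_angle_zero[of p j] assms by simp
next
  assume c: "cos (odd_angle p j) = 0"
  have "sin (2 * real 1 * odd_angle p j) = 0" using c by (simp add: sin_double)
  then show "j = h" using sin_multiple_nonzero[of 1 p j] assms by auto
qed

text \<open>
  The permutation of the odd angles reduces the sum to \<open>r = 1\<close>, where
  \<open>cos (2 y) / sin\<^sup>2 (2 y) = (csc\<^sup>2 y - sec\<^sup>2 y) / 4\<close>. At \<open>y = \<pi> / 2\<close> the left side and \<open>sec y\<close> are
  divisions by zero while \<open>csc y = 1\<close>, whence the correction at \<open>j = h\<close>.
\<close>

lemma sum_cos_csc2:
  assumes "p = 2 * h + 1" "odd r" "coprime r p"
  shows "(\<Sum>j<p. cos (2 * real r * odd_angle p j) / (sin (2 * real r * odd_angle p j))\<^sup>2)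
     = ((real p)\<^sup>2 - 1) / 6"
proof -
  have p: "p > 0" "odd p" using assms by simp_all
  define f where "f y = cos (2 * y) / (sin (2 * y))\<^sup>2" for y :: real
  have per: "f (y + real k * pi) = f y" for y and k :: nat
  proof -
    have "cos (2 * (real k * pi)) = 1" "sin (2 * (real k * pi)) = 0"
      using cos_2npi[of k] sin_2npi[of k] by (simp_all only: mult.assoc)
    then show ?thesis by (simp add: f_def distrib_left sin_add cos_add)
  qed
  have val: "f (odd_angle p j) = 1 / 4 * (1 / (sin (odd_angle p j))\<^sup>2 - 1 / (cos (odd_angle p j))\<^sup>2
        - (if j = h then 1 else 0))" if "j < p" for j
  proof (cases "j = h")
    case True
    then have c: "cos (odd_angle p j) = 0" using cos_odd_angle_eq_0_iff[OF assms(1) that] by simp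
    then have "(sin (odd_angle p j))\<^sup>2 = 1" by (simp add: sin_squared_eq)
    then show ?thesis using c True by (simp add: f_def sin_double)
  next
    case False
    then have c: "cos (odd_angle p j) \<noteq> 0" using cos_odd_angle_eq_0_iff[OF assms(1) that] by simp
    then show ?thesis unfolding f_def sin_double cos_double using False sin_odd_angle_pos[OF that]
      by (simp add: field_simps power2_eq_square)
  qed
  have "(\<Sum>j<p. f (real r * odd_angle p j)) = (\<Sum>j<p. f (odd_angle p j))"
    by (rule sum_odd_angle_multiple[OF p(2) assms(2,3) per])
  also have "\<dots> = (\<Sum>j<p. 1 / 4 * (1 / (sin (odd_angle p j))\<^sup>2 - 1 / (cos (odd_angle p j))\<^sup>2
        - (if j = h then 1 else 0)))"
    by (rule sum.cong) (simp_all add: val)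
  also have "\<dots> = 1 / 4 * ((\<Sum>j<p. 1 / (sin (odd_angle p j))\<^sup>2)
      - (\<Sum>j<p. 1 / (cos (odd_angle p j))\<^sup>2) - (\<Sum>j<p. if j = h then 1 else 0))"
    by (simp only: sum_distrib_left sum_subtractf right_diff_distrib)
  also have "(\<Sum>j<p. if j = h then 1 else 0 :: real) = 1" using assms(1) by simp
  also have "1 / 4 * ((\<Sum>j<p. 1 / (sin (odd_angle p j))\<^sup>2)
      - (\<Sum>j<p. 1 / (cos (odd_angle p j))\<^sup>2) - 1) = ((real p)\<^sup>2 - 1) / 6"
    unfolding sum_csc2_odd_angle[OF p(1)] sum_sec2_odd_angle[OF assms(1)] by (simp add: field_simps)
  finally show ?thesis by (simp add: f_def mult.assoc)
qed

section \<open>Evaluation of the signature\<close>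

lemma sum_odd_angle_fold:
  fixes g :: "real \<Rightarrow> real"
  assumes "p = 2 * h + 1" "\<And>y. g (pi - y) = g y" "g (pi / 2) = 0"
  shows "(\<Sum>j<p. g (odd_angle p j)) = 2 * (\<Sum>j<h. g (odd_angle p j))"
proof -
  have mid: "odd_angle p h = pi / 2" using assms(1) by (simp add: odd_angle_def field_simps)
  have "(\<Sum>j<h. g (odd_angle p (h + 1 + j))) = (\<Sum>j<h. g (odd_angle p (h + 1 + (h - Suc j))))"
    by (rule sum.nat_diff_reindex [symmetric])
  also have "\<dots> = (\<Sum>j<h. g (odd_angle p j))"
  proof (rule sum.cong)
    fix j assume "j \<in> {..<h}"
    then have "h + 1 + (h - Suc j) = p - Suc j" "j < p" using assms(1) by auto
    then show "g (odd_angle p (h + 1 + (h - Suc j))) = g (odd_angle p j)"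
      by (simp only: odd_angle_reflect assms(2))
  qed simp
  finally have upper: "(\<Sum>j<h. g (odd_angle p (h + 1 + j))) = (\<Sum>j<h. g (odd_angle p j))" .
  have "(\<Sum>j<p. g (odd_angle p j)) = (\<Sum>j<(h + 1) + h. g (odd_angle p j))"
    using assms(1) by (simp add: mult_2)
  also have "\<dots> = 2 * (\<Sum>j<h. g (odd_angle p j))"
    unfolding sum_lessThan_add upper using assms(3) by (simp add: mid)
  finally show ?thesis .
qed

text \<open>
  With \<open>b = 2 r a\<close>, expanding \<open>sin (b \<mp> 3 a) + 3 sin (b \<plusminus> a)\<close> leaves only
  \<open>4 (cos\<^sup>3 a sin b \<plusminus> sin\<^sup>3 a cos b)\<close>, since the multiples of \<open>sin a\<close> and \<open>cos a\<close> cancel against those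
  in \<open>sin (3 a)\<close> and \<open>cos (3 a)\<close>.
\<close>

lemma sigma2_T_term:
  fixes r p j :: nat
  assumes "j < p"
  defines "a \<equiv> odd_angle p j"
  shows "sigma2_T (int r) (int p) (2 * int j + 1) / (sin a ^ 3 * (sin (2 * real r * a))\<^sup>2)
    = 8 * (real p * (cot a ^ 3 / sin (2 * real r * a)) + cos (2 * real r * a) / (sin (2 * real r * a))\<^sup>2)"
proof -
  define b where "b = 2 * real r * a"
  have e: "pi * real_of_int ((2 * int r + c) * (2 * int j + 1)) / (2 * real_of_int (int p))
      = b + of_int c * a" for c :: int
    using assms(1) by (simp add: a_def b_def odd_angle_def field_simps)
  have T: "sigma2_T (int r) (int p) (2 * int j + 1)
     = (real p + 1) * (sin (b - 3 * a) + 3 * sin (b + a)) + (real p - 1) * (sin (b + 3 * a) + 3 * sin (b - a))"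
    using e[of "-3"] e[of 1] e[of 3] e[of "-1"]
    by (simp add: sigma2_T_def)
  have s3: "sin (3 * a) = 3 * sin a - 4 * sin a ^ 3"
  proof -
    have "sin (3 * a) = sin (2 * a + a)" by simp
    also have "\<dots> = 2 * sin a * (cos a)\<^sup>2 + ((cos a)\<^sup>2 - (sin a)\<^sup>2) * sin a"
      unfolding sin_add sin_double cos_double by (simp add: power2_eq_square algebra_simps)
    also have "\<dots> = 3 * sin a - 4 * sin a ^ 3"
      unfolding cos_squared_eq by (simp add: power2_eq_square power3_eq_cube algebra_simps)
    finally show ?thesis .
  qed
  have c3: "cos (3 * a) = 4 * cos a ^ 3 - 3 * cos a" by (rule cos_treble_cos)
  have T2: "sigma2_T (int r) (int p) (2 * int j + 1)
     = 8 * (real p * cos a ^ 3 * sin b + sin a ^ 3 * cos b)"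
    unfolding T sin_add sin_diff s3 c3 by (simp add: algebra_simps)
  have "sin a \<noteq> 0" using sin_odd_angle_pos[OF assms(1)] by (simp add: a_def)
  then show ?thesis
    unfolding T2 b_def[symmetric]
    by (cases "sin b = 0") (simp_all add: cot_def field_simps power2_eq_square power3_eq_cube)
qed

text \<open>
  The sum of \<open>cos / sin\<^sup>2\<close> over half of the odd angles is \<open>(p\<^sup>2 - 1) / 12\<close>, and this cancels the term
  \<open>1 / (6 p\<^sup>2) - 1 / 6\<close> of the Marche--Masbaum formula exactly.
\<close>

lemma sigma2_eq_cot3_csc_sum:
  fixes r p :: nat
  assumes "odd p" "odd r" "coprime r p"
  shows "sigma2 (of_nat r / of_nat p) = cot3_csc_sum r p / real p"
proof -
  have p: "p > 0" using assms by (auto intro: Nat.gr0I)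
  obtain h where h: "p = 2 * h + 1" using assms(1) by (elim oddE) simp
  define b where "b y = 2 * real r * y" for y
  define A where "A y = cot y ^ 3 / sin (b y)" for y
  define B where "B y = cos (b y) / (sin (b y))\<^sup>2" for y
  define x :: rat where "x = of_nat r / of_nat p"
  have q: "quotient_of x = (int r, int p)"
  proof -
    have "x = Fract (int r) (int p)" by (simp add: x_def Fract_of_int_quotient)
    then show ?thesis using p assms(3) by (simp add: quotient_of_Fract normalize_stable)
  qed
  have bpi: "sin (b (pi - y)) = - sin (b y)" "cos (b (pi - y)) = cos (b y)" for y
  proof -
    have e: "b (pi - y) = 2 * real r * pi - b y" by (simp add: b_def algebra_simps)
    show "sin (b (pi - y)) = - sin (b y)" "cos (b (pi - y)) = cos (b y)"
      unfolding e using cos_2npi[of r] sin_2npi[of r] by (simp_all add: sin_diff cos_diff)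
  qed
  have bhalf: "sin (b (pi / 2)) = 0" by (simp add: b_def)
  have symA: "A (pi - y) = A y" and symB: "B (pi - y) = B y" for y
    by (simp_all add: A_def B_def bpi cot_pi_minus power_minus_odd)
  have mid: "A (pi / 2) = 0" "B (pi / 2) = 0" by (simp_all add: A_def B_def bhalf)
  have foldA: "(\<Sum>j<h. A (odd_angle p j)) = cot3_csc_sum r p / 2"
    using sum_odd_angle_fold[OF h symA mid(1)] by (simp add: A_def cot3_csc_sum_def b_def)
  have foldB: "(\<Sum>j<h. B (odd_angle p j)) = ((real p)\<^sup>2 - 1) / 12"
    using sum_odd_angle_fold[OF h symB mid(2)] sum_cos_csc2[OF h assms(2,3)]
    by (simp add: B_def b_def)
  have idx: "{n. 1 \<le> n \<and> n \<le> int p - 2 \<and> odd n} = (\<lambda>j. 2 * int j + 1) ` {..<h}"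
  proof (intro set_eqI iffI)
    fix n assume n: "n \<in> {n. 1 \<le> n \<and> n \<le> int p - 2 \<and> odd n}"
    then obtain k where k: "n = 2 * k + 1" by (auto elim: oddE)
    then have "k \<ge> 0" "nat k < h" using n h by auto
    then show "n \<in> (\<lambda>j. 2 * int j + 1) ` {..<h}" using k by (auto intro!: image_eqI[of _ _ "nat k"])
  qed (use h in auto)
  define g where "g n = sigma2_T (int r) (int p) n /
             ((sin (pi * real_of_int n / (2 * real_of_int (int p)))) ^ 3 *
              (sin (pi * real_of_int n * real_of_rat x))\<^sup>2)" for n
  have summand: "g (2 * int j + 1)
      = 8 * (real p * A (odd_angle p j) + B (odd_angle p j))" if "j < h" for j
  proof -
    have "pi * real_of_int (2 * int j + 1) / (2 * real_of_int (int p)) = odd_angle p j"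
      by (simp add: odd_angle_def)
    moreover have "pi * real_of_int (2 * int j + 1) * real_of_rat x = 2 * real r * odd_angle p j"
      using p by (simp add: odd_angle_def x_def of_rat_divide field_simps)
    moreover have "j < p" using that h by simp
    ultimately show ?thesis
      using sigma2_T_term[of j p r] by (simp only: g_def A_def B_def b_def)
  qed
  have "sum g {n. 1 \<le> n \<and> n \<le> int p - 2 \<and> odd n} = (\<Sum>j<h. g (2 * int j + 1))"
    by (simp add: idx sum.reindex inj_on_def)
  also have "\<dots> = (\<Sum>j<h. 8 * (real p * A (odd_angle p j) + B (odd_angle p j)))"
    by (rule sum.cong) (simp_all only: summand lessThan_iff)
  also have "\<dots> = 8 * (real p * (\<Sum>j<h. A (odd_angle p j)) + (\<Sum>j<h. B (odd_angle p j)))"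
    by (simp add: sum_distrib_left[symmetric] sum.distrib)
  also have "\<dots> = 4 * real p * cot3_csc_sum r p + 2 * ((real p)\<^sup>2 - 1) / 3"
    by (simp add: foldA foldB)
  finally have "sigma2 x = 1 / (6 * (real p)\<^sup>2) - 1 / 6
       + 1 / (4 * (real p)\<^sup>2) * (4 * real p * cot3_csc_sum r p + 2 * ((real p)\<^sup>2 - 1) / 3)"
    unfolding sigma2_def q by (simp add: g_def)
  also have "\<dots> = cot3_csc_sum r p / real p"
    using p by (simp add: field_simps power2_eq_square)
  finally show ?thesis by (simp add: x_def)
qed

theorem theorem1p2:
  fixes r p :: int and x :: rat
  assumes "odd r" and "odd p" and "coprime r p"
    and "1 \<le> r" and "r < p"
    and "x = of_int r / of_int p"
  shows "sigma2 (x / (2 * x + 1)) - sigma2 x =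
           real_of_int (2 * r\<^sup>2 + 2 * r * p + p\<^sup>2 - 1)"
proof -
  obtain r' p' :: nat where n: "r = int r'" "p = int p'"
    using assms(4,5) by (metis int_nat_eq less_imp_le order.trans zero_le_one)
  have odd: "odd p'" "odd r'" and cop: "coprime r' p'"
    using assms(1-3) by (simp_all add: n)
  have p: "p' > 0" and r: "r' > 0" using odd by (auto intro: Nat.gr0I)
  have x: "x = of_nat r' / of_nat p'" using assms(6) by (simp add: n)
  have x': "x / (2 * x + 1) = of_nat r' / of_nat (p' + 2 * r')"
    unfolding x using p r by (simp add: field_simps)
  have cop': "coprime r' (p' + 2 * r')"
    using cop gcd_add_mult[of r' 2 p'] by (simp add: coprime_iff_gcd_eq_1 add.commute)
  have "sigma2 (x / (2 * x + 1)) - sigma2 x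
      = cot3_csc_sum r' (p' + 2 * r') / real (p' + 2 * r') - cot3_csc_sum r' p' / real p'"
    unfolding x' unfolding x
    using odd cop cop' by (simp add: sigma2_eq_cot3_csc_sum del: of_nat_add of_nat_mult)
  then show ?thesis
    unfolding cot3_csc_sum_shift[OF p r cop] by (simp add: n)
qed

end
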